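(* Let $n\ge1$, let $J$ be a set of any cardinality, and let $G=(\mathbb{R}_+^* )^J$. Let $A=(a_{i,j})_{0\le i,j\le n}$ be a consistent PC matrix with coefficients in $G$. Then $A$ is the holonomy matrix of a flat connection on $\Delta_n$. Explicitly, there is a unique affine function $f:\Delta_n\to\mathbb{R}^J$ with $f(s_0)=0$ and $f(s_{i-1})-f(s_i)=-\ln(a_{i-1,i})$ for $1\le i\le n$ (logarithm taken componentwise), and the connection $\theta=df$ is flat with holonomy matrix $A$.
   Context: A PC matrix with coefficients in $G$ indexed by $\{0,\ldots,n\}$ is a family $(a_{i,j})$ in $G$ with $a_{j,i}=a_{i,j}^{-1}$ and $a_{i,i}=1_G$. It is consistent if $a_{i,k}=a_{i,j}a_{j,k}$ for all $i,j,k$ (here $G$ is abelian, so this is the same as $a_{i,k}=a_{j,k}a_{i,j}$). $\Delta_n=\{(x_0,\ldots,x_n)\in\mathbb{R}^{n+1}:\sum x_i=1,\ x_i\ge0\}$, with vertices $s_0,\ldots,s_n$ the standard basis vectors and $[s_i,s_j]$ the oriented affine edge from $s_i$ to $s_j$. The Lie algebra of $G$ is $\mathbb{R}^J$ with componentwise exponential. A connection is a smooth 1-form $\theta\in\Omega^1(\Delta_n,\mathbb{R}^J)$; it is flat if $d\theta=0$. Its holonomy along the edge is $Hol([s_i,s_j])=\exp\left(\int_{[s_i,s_j]}\theta\right)$, and its holonomy matrix is $(Hol([s_i,s_j]))_{0\le i,j\le n}$. *)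

theory Defs
  imports "HOL-Analysis.Analysis" "HOL-Algebra.Product_Groups"
begin

section \<open>Pairwise comparison matrices over a group\<close>

definition pc_matrix :: "('g, 'c) monoid_scheme \<Rightarrow> nat \<Rightarrow> (nat \<Rightarrow> nat \<Rightarrow> 'g) \<Rightarrow> bool" where
  "pc_matrix G n A \<longleftrightarrow>
     (\<forall>i\<le>n. \<forall>j\<le>n. A i j \<in> carrier G) \<and>
     (\<forall>i\<le>n. \<forall>j\<le>n. A j i = inv\<^bsub>G\<^esub> (A i j)) \<and>
     (\<forall>i\<le>n. A i i = \<one>\<^bsub>G\<^esub>)"

definition consistent :: "('g, 'c) monoid_scheme \<Rightarrow> nat \<Rightarrow> (nat \<Rightarrow> nat \<Rightarrow> 'g) \<Rightarrow> bool" where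
  "consistent G n A \<longleftrightarrow>
     (\<forall>i\<le>n. \<forall>j\<le>n. \<forall>k\<le>n. A i k = A i j \<otimes>\<^bsub>G\<^esub> A j k)"


section \<open>The group of positive real families and its Lie algebra\<close>

definition pos_real_group :: "real monoid" where
  "pos_real_group = \<lparr>carrier = {0<..}, monoid.mult = (*), one = 1\<rparr>"

definition pos_real_power :: "'j set \<Rightarrow> ('j \<Rightarrow> real) monoid" where
  "pos_real_power J = product_group J (\<lambda>_. pos_real_group)"

lemma comm_group_pos_real_group: "comm_group pos_real_group"
proof (rule comm_groupI)
  fix x assume "x \<in> carrier pos_real_group"
  then show "\<exists>y\<in>carrier pos_real_group. y \<otimes>\<^bsub>pos_real_group\<^esub> x = \<one>\<^bsub>pos_real_group\<^esub>"
    by (intro bexI[of _ "inverse x"]) (auto simp: pos_real_group_def)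
qed (auto simp: pos_real_group_def)

lemma comm_group_pos_real_power: "comm_group (pos_real_power J)"
proof -
  interpret P: comm_group pos_real_group
    by (rule comm_group_pos_real_group)
  have "group (pos_real_power J)"
    by (simp add: pos_real_power_def P.group_axioms)
  then show ?thesis
    by (rule group.group_comm_groupI)
      (auto simp: pos_real_power_def PiE_iff P.m_comm intro!: restrict_ext)
qed

text \<open>
  Families indexed by \<open>J\<close> are functions that take the value \<^term>\<open>undefined\<close>
  outside \<open>J\<close>, as in \<^const>\<open>product_group\<close>, so that equality of families is
  equality of functions.  \<open>J\<close> may be empty, finite or infinite.
\<close>

definition real_power :: "'j set \<Rightarrow> ('j \<Rightarrow> real) set" where
  "real_power J = (J \<rightarrow>\<^sub>E UNIV)"

definition exp_power :: "'j set \<Rightarrow> ('j \<Rightarrow> real) \<Rightarrow> ('j \<Rightarrow> real)" where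
  "exp_power J w = (\<lambda>j\<in>J. exp (w j))"


section \<open>The standard simplex\<close>

text \<open>
  The coordinates are indexed by a finite type; a bijection \<open>e\<close> from \<open>{0..n}\<close>
  onto that type names them \<open>x\<^sub>0, \<dots>, x\<^sub>n\<close>.
\<close>

definition std_simplex :: "(real ^ 'm) set" where
  "std_simplex = {x. (\<Sum>k\<in>UNIV. x $ k) = 1 \<and> (\<forall>k. 0 \<le> x $ k)}"

definition vertex :: "(nat \<Rightarrow> 'm) \<Rightarrow> nat \<Rightarrow> real ^ 'm" where
  "vertex e i = axis (e i) 1"

text \<open>The tangent space of the simplex, the same at each of its points.\<close>

definition simplex_tangent :: "(real ^ 'm) set" where
  "simplex_tangent = {v. (\<Sum>k\<in>UNIV. v $ k) = 0}"

definition affine_fun :: "'j set \<Rightarrow> (real ^ 'm \<Rightarrow> 'j \<Rightarrow> real) \<Rightarrow> bool" where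
  "affine_fun J f \<longleftrightarrow>
     f \<in> (std_simplex \<rightarrow>\<^sub>E real_power J) \<and>
     (\<forall>x\<in>std_simplex. \<forall>y\<in>std_simplex. \<forall>t\<in>{0..1}. \<forall>j\<in>J.
        f ((1 - t) *\<^sub>R x + t *\<^sub>R y) j = (1 - t) * f x j + t * f y j)"


section \<open>Smooth functions\<close>

primrec Ck_on_open :: "nat \<Rightarrow> 'a::euclidean_space set \<Rightarrow> ('a \<Rightarrow> real) \<Rightarrow> bool" where
  "Ck_on_open 0 U f \<longleftrightarrow> continuous_on U f"
| "Ck_on_open (Suc k) U f \<longleftrightarrow>
     (\<exists>f'. (\<forall>x\<in>U. (f has_derivative f' x) (at x)) \<and> (\<forall>v. Ck_on_open k U (\<lambda>x. f' x v)))"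

text \<open>On an arbitrary set, smooth means having a smooth extension to an open neighbourhood.\<close>

definition smooth_fun_on :: "'a::euclidean_space set \<Rightarrow> ('a \<Rightarrow> real) \<Rightarrow> bool" where
  "smooth_fun_on S f \<longleftrightarrow>
     (\<exists>U g. open U \<and> S \<subseteq> U \<and> (\<forall>k. Ck_on_open k U g) \<and> (\<forall>x\<in>S. g x = f x))"


section \<open>Connections on the simplex, flatness and holonomy\<close>

text \<open>
  A 1-form assigns to a point of the simplex a linear map from the tangent space to
  the families indexed by \<open>J\<close>.  That target carries the product structure, so
  smoothness, derivatives and integrals are taken in each component \<open>j\<in>J\<close>.
\<close>

definition connection :: "'j set \<Rightarrow> (real ^ 'm \<Rightarrow> real ^ 'm \<Rightarrow> 'j \<Rightarrow> real) \<Rightarrow> bool" where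
  "connection J \<theta> \<longleftrightarrow>
     \<theta> \<in> (std_simplex \<rightarrow>\<^sub>E simplex_tangent \<rightarrow>\<^sub>E real_power J) \<and>
     (\<forall>x\<in>std_simplex. \<forall>j\<in>J.
        (\<forall>u\<in>simplex_tangent. \<forall>v\<in>simplex_tangent. \<theta> x (u + v) j = \<theta> x u j + \<theta> x v j) \<and>
        (\<forall>c. \<forall>v\<in>simplex_tangent. \<theta> x (c *\<^sub>R v) j = c * \<theta> x v j)) \<and>
     (\<forall>v\<in>simplex_tangent. \<forall>j\<in>J. smooth_fun_on std_simplex (\<lambda>x. \<theta> x v j))"

text \<open>
  Derivatives are taken within the simplex; they are determined exactly on its
  tangent space, also at boundary points, and are used only on tangent vectors.
\<close>

definition simplex_deriv :: "(real ^ 'm \<Rightarrow> real) \<Rightarrow> real ^ 'm \<Rightarrow> real ^ 'm \<Rightarrow> real" where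
  "simplex_deriv g x v = frechet_derivative g (at x within std_simplex) v"

definition differential ::
  "'j set \<Rightarrow> (real ^ 'm \<Rightarrow> 'j \<Rightarrow> real) \<Rightarrow> real ^ 'm \<Rightarrow> real ^ 'm \<Rightarrow> 'j \<Rightarrow> real" where
  "differential J f =
     (\<lambda>x\<in>std_simplex. \<lambda>v\<in>simplex_tangent. \<lambda>j\<in>J. simplex_deriv (\<lambda>y. f y j) x v)"

text \<open>
  The exterior derivative of a 1-form, evaluated on constant vector fields
  \<open>u\<close> and \<open>v\<close>, whose bracket vanishes.
\<close>

definition ext_deriv ::
  "'j set \<Rightarrow> (real ^ 'm \<Rightarrow> real ^ 'm \<Rightarrow> 'j \<Rightarrow> real)
     \<Rightarrow> real ^ 'm \<Rightarrow> real ^ 'm \<Rightarrow> real ^ 'm \<Rightarrow> 'j \<Rightarrow> real" where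
  "ext_deriv J \<theta> =
     (\<lambda>x\<in>std_simplex. \<lambda>u\<in>simplex_tangent. \<lambda>v\<in>simplex_tangent. \<lambda>j\<in>J.
        simplex_deriv (\<lambda>y. \<theta> y v j) x u - simplex_deriv (\<lambda>y. \<theta> y u j) x v)"

definition flat :: "'j set \<Rightarrow> (real ^ 'm \<Rightarrow> real ^ 'm \<Rightarrow> 'j \<Rightarrow> real) \<Rightarrow> bool" where
  "flat J \<theta> \<longleftrightarrow>
     (\<forall>x\<in>std_simplex. \<forall>u\<in>simplex_tangent. \<forall>v\<in>simplex_tangent. \<forall>j\<in>J.
        ext_deriv J \<theta> x u v j = 0)"

definition line_integral ::
  "'j set \<Rightarrow> (real \<Rightarrow> real ^ 'm) \<Rightarrow> (real ^ 'm \<Rightarrow> real ^ 'm \<Rightarrow> 'j \<Rightarrow> real) \<Rightarrow> 'j \<Rightarrow> real" where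
  "line_integral J \<gamma> \<theta> =
     (\<lambda>j\<in>J. integral {0..1} (\<lambda>t. \<theta> (\<gamma> t) (vector_derivative \<gamma> (at t within {0..1})) j))"

definition holonomy ::
  "'j set \<Rightarrow> (nat \<Rightarrow> 'm) \<Rightarrow> (real ^ 'm \<Rightarrow> real ^ 'm \<Rightarrow> 'j \<Rightarrow> real) \<Rightarrow> nat \<Rightarrow> nat \<Rightarrow> 'j \<Rightarrow> real" where
  "holonomy J e \<theta> i j =
     exp_power J (line_integral J (linepath (vertex e i) (vertex e j)) \<theta>)"

definition is_holonomy_matrix ::
  "'j set \<Rightarrow> nat \<Rightarrow> (nat \<Rightarrow> 'm) \<Rightarrow> (real ^ 'm \<Rightarrow> real ^ 'm \<Rightarrow> 'j \<Rightarrow> real)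
     \<Rightarrow> (nat \<Rightarrow> nat \<Rightarrow> 'j \<Rightarrow> real) \<Rightarrow> bool" where
  "is_holonomy_matrix J n e \<theta> A \<longleftrightarrow> (\<forall>i\<le>n. \<forall>j\<le>n. A i j = holonomy J e \<theta> i j)"

definition is_log_primitive ::
  "'j set \<Rightarrow> nat \<Rightarrow> (nat \<Rightarrow> 'm) \<Rightarrow> (nat \<Rightarrow> nat \<Rightarrow> 'j \<Rightarrow> real) \<Rightarrow> (real ^ 'm \<Rightarrow> 'j \<Rightarrow> real) \<Rightarrow> bool" where
  "is_log_primitive J n e A f \<longleftrightarrow>
     affine_fun J f \<and>
     (\<forall>j\<in>J. f (vertex e 0) j = 0) \<and>
     (\<forall>i\<in>{1..n}. \<forall>j\<in>J.
        f (vertex e (i - 1)) j - f (vertex e i) j = - ln (A (i - 1) i j))"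

end

(* In barycentric coordinates an affine function on the simplex is determined by its values at
   the vertices.  Consistency telescopes the conditions on f to f(s_i) = ln a_{0,i}; conversely,
   the affine function with these values has constant differential, which is therefore flat, and
   its integral along [s_i, s_j] is ln a_{0,j} - ln a_{0,i} = ln a_{i,j}. *)
theory Submission
  imports Defs
begin

section \<open>Barycentric coordinates and derivatives on the simplex\<close>

lemma axis_in_std_simplex: "axis k 1 \<in> std_simplex"
  by (auto simp: std_simplex_def axis_def)

lemma convex_std_simplex: "convex std_simplex"
  unfolding convex_def std_simplex_def
  by (auto simp: sum.distrib simp flip: sum_distrib_left)

lemma diff_in_simplex_tangent:
  "x \<in> std_simplex \<Longrightarrow> y \<in> std_simplex \<Longrightarrow> y - x \<in> simplex_tangent"
  by (auto simp: std_simplex_def simplex_tangent_def sum_subtractf)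

lemma vec_eq_sum_axis: "(\<Sum>k\<in>UNIV. (x $ k) *\<^sub>R axis k 1) = (x :: real ^ 'm::finite)"
  by (simp add: basis_expansion flip: scalar_mult_eq_scaleR)

text \<open>\<open>affine_fun\<close> speaks of two points only. It makes both \<open>f\<close> and
  \<open>-f\<close> convex in component \<open>j\<close>, so Jensen's inequality for
  \<open>x\<close> as a combination of the vertices holds in both directions.\<close>

lemma affine_fun_barycentric:
  fixes f :: "real ^ 'm::finite \<Rightarrow> 'j \<Rightarrow> real"
  assumes f: "affine_fun J f" and x: "x \<in> std_simplex" and j: "j \<in> J"
  shows "f x j = (\<Sum>k\<in>UNIV. x $ k * f (axis k 1) j)"
proof -
  have aff: "f ((1 - t) *\<^sub>R y + t *\<^sub>R z) j = (1 - t) * f y j + t * f z j"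
    if "y \<in> std_simplex" "z \<in> std_simplex" "0 \<le> t" "t \<le> 1" for y z t
    using f j that by (auto simp: affine_fun_def)
  have convex: "convex_on std_simplex (\<lambda>y. f y j)"
    by (rule convex_onI) (auto simp: aff convex_std_simplex)
  have concave: "convex_on std_simplex (\<lambda>y. - f y j)"
    by (rule convex_onI) (auto simp: aff convex_std_simplex)
  have *: "h x \<le> (\<Sum>k\<in>UNIV. x $ k * h (axis k 1))" if "convex_on std_simplex h" for h
  proof -
    have "h (\<Sum>k\<in>UNIV. (x $ k) *\<^sub>R axis k 1) \<le> (\<Sum>k\<in>UNIV. x $ k * h (axis k 1))"
      using x by (intro convex_on_sum[OF _ _ that] axis_in_std_simplex) (auto simp: std_simplex_def)
    then show ?thesis
      by (simp add: vec_eq_sum_axis)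
  qed
  from *[OF convex] *[OF concave] show ?thesis
    by (simp add: sum_negf)
qed

text \<open>
  A derivative within the simplex is unique only on tangent vectors: the segments from
  \<open>x\<close> to the vertices determine it, since \<open>v\<close> is the sum of the \<open>v\<^sub>k (s\<^sub>k - x)\<close>.
\<close>

lemma simplex_deriv_affine:
  fixes x v :: "real ^ 'm::finite"
  assumes L: "linear L" and g: "\<And>y. y \<in> std_simplex \<Longrightarrow> g y = L y + b"
    and x: "x \<in> std_simplex" and v: "v \<in> simplex_tangent"
  shows "simplex_deriv g x v = L v"
proof -
  \<comment> \<open>\<open>frechet_derivative\<close> selects some derivative; off the tangent space
    it may differ from \<open>L\<close>, so \<open>D\<close> and \<open>L\<close> are compared on
    tangent vectors only.\<close>
  define D where "D = frechet_derivative g (at x within std_simplex)"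
  have "((\<lambda>y. L y + b) has_derivative L) (at x within std_simplex)"
    using linear_imp_has_derivative[OF L] by (auto intro!: derivative_eq_intros)
  then have "(g has_derivative L) (at x within std_simplex)"
    by (rule has_derivative_transform[OF x, rotated]) (simp add: g)
  then have D: "(g has_derivative D) (at x within std_simplex)"
    unfolding D_def using differentiableI frechet_derivative_works by blast
  then have linear_D: "linear D"
    by (rule has_derivative_linear)
  have D_diff: "D (y - x) = L (y - x)" if y: "y \<in> std_simplex" for y
  proof -
    \<comment> \<open>The segment from \<open>x\<close> to \<open>y\<close> stays in the simplex
      even when \<open>x\<close> is a boundary point, which gives a one-sided derivative at
      \<open>t = 0\<close>.\<close>
    define p where "p = (\<lambda>t::real. x + t *\<^sub>R (y - x))"
    have p: "p t \<in> std_simplex" if "t \<in> {0..1}" for t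
      using convexD_alt[OF convex_std_simplex x y, of t] that
      by (simp add: p_def algebra_simps)
    have "(p has_derivative (\<lambda>t. t *\<^sub>R (y - x))) (at 0 within {0..1})"
      unfolding p_def by (auto intro!: derivative_eq_intros)
    moreover have "(g has_derivative D) (at (p 0) within p ` {0..1})"
      by (rule has_derivative_subset[of _ _ _ std_simplex]) (use D p in \<open>auto simp: p_def\<close>)
    ultimately have "(g \<circ> p has_derivative D \<circ> (\<lambda>t. t *\<^sub>R (y - x))) (at 0 within {0..1})"
      by (rule diff_chain_within)
    then have 1: "(g \<circ> p has_vector_derivative D (y - x)) (at 0 within {0..1})"
      by (simp add: has_vector_derivative_def o_def linear_scale[OF linear_D])
    have "((\<lambda>t. L x + b + t *\<^sub>R L (y - x)) has_vector_derivative L (y - x)) (at 0 within {0..1})"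
      by (auto intro!: derivative_eq_intros simp: has_vector_derivative_def)
    then have 2: "(g \<circ> p has_vector_derivative L (y - x)) (at 0 within {0..1})"
      by (rule has_vector_derivative_transform[rotated 2])
        (use g[OF p] in \<open>auto simp: p_def linear_add[OF L] linear_scale[OF L]\<close>)
    \<comment> \<open>Derivatives within a nondegenerate interval are unique, also at its endpoint
      0; folding \<open>box_real\<close> produces the \<open>cbox\<close> form of that rule.\<close>
    show ?thesis
      using vector_derivative_unique_within_closed_interval[of 0 1 0 "g \<circ> p",
          OF _ _ 1[folded box_real] 2[folded box_real]]
      by simp
  qed
  \<comment> \<open>The coordinates of \<open>v\<close> sum to zero, so the multiples of
    \<open>x\<close> cancel.\<close>
  have "v = (\<Sum>k\<in>UNIV. (v $ k) *\<^sub>R (axis k 1 - x))"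
    using v by (simp add: scaleR_diff_right sum_subtractf vec_eq_sum_axis simplex_tangent_def
        flip: scaleR_sum_left)
  then have "M v = (\<Sum>k\<in>UNIV. (v $ k) *\<^sub>R M (axis k 1 - x))" if "linear M" for M :: "_ \<Rightarrow> real"
    using linear_sum[OF that] linear_scale[OF that] by (metis (no_types, lifting) sum.cong)
  from this[OF linear_D] this[OF L] show ?thesis
    by (simp add: simplex_deriv_def D_diff[OF axis_in_std_simplex] flip: D_def)
qed

section \<open>Forms with constant coefficients and their affine primitives\<close>

lemma Ck_on_open_const: "Ck_on_open k U (\<lambda>_. c)"
proof (induction k arbitrary: c)
  case (Suc k)
  then show ?case
    by (auto intro!: exI[of _ "\<lambda>_ _. 0"])
qed auto

text \<open>Constancy is asked on \<open>S\<close> only, since forms are restricted to the simplex;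
  the same constant on the whole space is the smooth extension.\<close>

lemma smooth_fun_on_const: "(\<And>x. x \<in> S \<Longrightarrow> f x = c) \<Longrightarrow> smooth_fun_on S f"
  unfolding smooth_fun_on_def
  by (intro exI[of _ UNIV] exI[of _ "\<lambda>_. c"]) (auto simp: Ck_on_open_const)

text \<open>The affine interpolation of the vertex values \<open>c\<close>, where a vertex is named
  by its coordinate rather than by its number.\<close>

definition bary_fun ::
  "'j set \<Rightarrow> ('m::finite \<Rightarrow> 'j \<Rightarrow> real) \<Rightarrow> real ^ 'm \<Rightarrow> 'j \<Rightarrow> real" where
  "bary_fun J c = (\<lambda>x\<in>std_simplex. \<lambda>j\<in>J. \<Sum>k\<in>UNIV. x $ k * c k j)"

text \<open>The form \<open>\<Sum>k. c k dx_k\<close>, which will be the differential of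
  \<open>bary_fun J c\<close>; the closed formula makes it explicit on every tangent vector.\<close>

definition const_form ::
  "'j set \<Rightarrow> ('m::finite \<Rightarrow> 'j \<Rightarrow> real) \<Rightarrow> real ^ 'm \<Rightarrow> real ^ 'm \<Rightarrow> 'j \<Rightarrow> real" where
  "const_form J c = (\<lambda>x\<in>std_simplex. \<lambda>v\<in>simplex_tangent. \<lambda>j\<in>J. \<Sum>k\<in>UNIV. v $ k * c k j)"

lemma linear_bary: "linear (\<lambda>v :: real ^ 'm::finite. \<Sum>k\<in>UNIV. v $ k * c k)"
  by (rule linearI) (simp_all add: algebra_simps sum.distrib sum_distrib_left)

lemma sum_axis_mult: "(\<Sum>k\<in>UNIV. (axis i 1 :: real ^ 'm::finite) $ k * c k) = c i"
proof -
  have "(axis i 1 :: real ^ 'm) $ k * c k = (if k = i then c k else 0)" for k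
    by (simp add: axis_def)
  then show ?thesis
    by simp
qed

lemma bary_fun_axis: "j \<in> J \<Longrightarrow> bary_fun J c (axis k 1) j = c k j"
  by (simp add: bary_fun_def axis_in_std_simplex sum_axis_mult)

lemma affine_fun_bary_fun:
  fixes c :: "'m::finite \<Rightarrow> 'j \<Rightarrow> real"
  shows "affine_fun J (bary_fun J c)"
proof -
  have "(1 - t) *\<^sub>R x + t *\<^sub>R y \<in> std_simplex"
    if "x \<in> std_simplex" "y \<in> std_simplex" "0 \<le> t" "t \<le> 1" for x y :: "real ^ 'm" and t
    using convexD_alt[OF convex_std_simplex] that by blast
  then show ?thesis
    by (auto simp: affine_fun_def bary_fun_def real_power_def sum.distrib sum_distrib_left
        distrib_right mult.assoc)
qed

text \<open>On the simplex the barycentric formula decides; outside the simplex and outside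
  \<open>J\<close> both sides are \<open>undefined\<close>. This yields equality of functions, as
  uniqueness requires.\<close>

lemma affine_fun_eq_bary_fun:
  assumes f: "affine_fun J f" and c: "\<And>k j. j \<in> J \<Longrightarrow> f (axis k 1) j = c k j"
  shows "f = bary_fun J c"
proof
  fix x
  have fS: "f \<in> (std_simplex \<rightarrow>\<^sub>E (J \<rightarrow>\<^sub>E UNIV))"
    using f by (simp add: affine_fun_def real_power_def)
  show "f x = bary_fun J c x"
  proof (cases "x \<in> std_simplex")
    case True
    show ?thesis
    proof
      fix j
      show "f x j = bary_fun J c x j"
        using True fS affine_fun_barycentric[OF f True, of j]
        by (cases "j \<in> J") (auto simp: bary_fun_def c PiE_arb[OF PiE_mem[OF fS True]])
    qed
  qed (use PiE_arb[OF fS] in \<open>auto simp: bary_fun_def\<close>)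
qed

text \<open>On the simplex each component agrees with a linear map of the ambient space, which is
  its own derivative on tangent vectors.\<close>

lemma differential_bary_fun:
  fixes c :: "'m::finite \<Rightarrow> 'j \<Rightarrow> real"
  shows "differential J (bary_fun J c) = const_form J c"
  unfolding differential_def const_form_def
proof (intro restrict_ext)
  fix x v :: "real ^ 'm" and j
  assume "x \<in> std_simplex" "v \<in> simplex_tangent" "j \<in> J"
  then show "simplex_deriv (\<lambda>y. bary_fun J c y j) x v = (\<Sum>k\<in>UNIV. v $ k * c k j)"
    by (intro simplex_deriv_affine[where b = 0] linear_bary) (auto simp: bary_fun_def)
qed

lemma connection_const_form:
  fixes c :: "'m::finite \<Rightarrow> 'j \<Rightarrow> real"
  shows "connection J (const_form J c)"
proof -
  have "u + v \<in> simplex_tangent" "a *\<^sub>R v \<in> simplex_tangent"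
    if "u \<in> simplex_tangent" "v \<in> simplex_tangent" for u v :: "real ^ 'm" and a
    using that by (auto simp: simplex_tangent_def sum.distrib simp flip: sum_distrib_left)
  then show ?thesis
    unfolding connection_def
    by (auto simp: const_form_def real_power_def sum.distrib sum_distrib_left distrib_right mult.assoc
        intro!: smooth_fun_on_const)
qed

text \<open>On a fixed tangent vector the form does not vary with the base point, so both terms of
  the exterior derivative vanish.\<close>

lemma flat_const_form:
  fixes c :: "'m::finite \<Rightarrow> 'j \<Rightarrow> real"
  shows "flat J (const_form J c)"
proof -
  have "simplex_deriv (\<lambda>y. const_form J c y v j) x u = 0"
    if "x \<in> std_simplex" "u \<in> simplex_tangent" "v \<in> simplex_tangent" "j \<in> J" for x u v j
    using that
    by (intro simplex_deriv_affine[where L = "\<lambda>_. 0" and b = "\<Sum>k\<in>UNIV. v $ k * c k j"])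
      (auto simp: const_form_def intro: linear_zero)
  then show ?thesis
    by (simp add: flat_def ext_deriv_def)
qed

text \<open>The edge has constant velocity, so the integrand is the constant difference of the two
  vertex values, integrated over an interval of length 1.\<close>

lemma holonomy_const_form:
  fixes c :: "'m::finite \<Rightarrow> 'j \<Rightarrow> real"
  assumes j: "j \<in> J"
  shows "holonomy J e (const_form J c) i k j = exp (c (e k) j - c (e i) j)"
proof -
  let ?p = "linepath (vertex e i) (vertex e k) :: real \<Rightarrow> real ^ 'm"
  have "integral {0..1} (\<lambda>t. const_form J c (?p t) (vector_derivative ?p (at t within {0..1})) j)
      = integral {0..1} (\<lambda>t::real. c (e k) j - c (e i) j)"
  proof (rule integral_cong)
    fix t :: real assume t: "t \<in> {0..1}"
    have "?p t \<in> std_simplex"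
      using convexD_alt[OF convex_std_simplex axis_in_std_simplex axis_in_std_simplex] t
      by (auto simp: linepath_def vertex_def)
    moreover have "vertex e k - vertex e i \<in> simplex_tangent"
      by (simp add: vertex_def diff_in_simplex_tangent axis_in_std_simplex)
    moreover have "vector_derivative ?p (at t within {0..1}) = vertex e k - vertex e i"
      using t by (intro vector_derivative_linepath_within) auto
    ultimately show "const_form J c (?p t) (vector_derivative ?p (at t within {0..1})) j
        = c (e k) j - c (e i) j"
      \<comment> \<open>The difference of vertices must stay unsplit for \<open>linear_diff\<close>
        to match, hence the deleted simp rule.\<close>
      using j by (simp add: const_form_def vertex_def linear_diff[OF linear_bary] sum_axis_mult
        del: vector_minus_component)
  qed
  then show ?thesis
    using j by (simp add: holonomy_def exp_power_def line_integral_def)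
qed

section \<open>Logarithms of a consistent matrix as vertex values\<close>

theorem mainTheorem5:
  fixes n :: nat and e :: "nat \<Rightarrow> 'm::finite" and J :: "'j set"
    and A :: "nat \<Rightarrow> nat \<Rightarrow> 'j \<Rightarrow> real"
  assumes "n \<ge> 1"
    and "bij_betw e {0..n} UNIV"
    and "pc_matrix (pos_real_power J) n A"
    and "consistent (pos_real_power J) n A"
  shows "(\<exists>\<theta> :: real ^ 'm \<Rightarrow> real ^ 'm \<Rightarrow> 'j \<Rightarrow> real.
            connection J \<theta> \<and> flat J \<theta> \<and> is_holonomy_matrix J n e \<theta> A) \<and>
         (\<exists>!f. is_log_primitive J n e A f) \<and>
         (\<forall>f. is_log_primitive J n e A f \<longrightarrow>
            connection J (differential J f) \<and> flat J (differential J f) \<and>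
            is_holonomy_matrix J n e (differential J f) A)"
proof -
  note bij = assms(2)
  have carrier: "A i k \<in> (J \<rightarrow>\<^sub>E {0<..})" if "i \<le> n" "k \<le> n" for i k
  proof -
    have "A i k \<in> carrier (pos_real_power J)"
      using assms(3) that unfolding pc_matrix_def by blast
    then show ?thesis
      by (simp add: pos_real_power_def pos_real_group_def)
  qed
  then have pos: "A i k j > 0" if "i \<le> n" "k \<le> n" "j \<in> J" for i k j
    using PiE_mem[OF carrier] that by fastforce
  have one: "A 0 0 j = 1" if "j \<in> J" for j
  proof -
    have "A 0 0 = \<one>\<^bsub>pos_real_power J\<^esub>"
      using assms(3) unfolding pc_matrix_def by blast
    then show ?thesis
      using that by (simp add: pos_real_power_def pos_real_group_def)
  qed
  have mult: "A i k j = A i l j * A l k j" if "i \<le> n" "l \<le> n" "k \<le> n" "j \<in> J" for i l k j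
  proof -
    have "A i k = A i l \<otimes>\<^bsub>pos_real_power J\<^esub> A l k"
      using assms(4) that unfolding consistent_def by blast
    then show ?thesis
      using that by (simp add: pos_real_power_def pos_real_group_def)
  qed
  \<comment> \<open>Consistency for the triple \<open>0, i, k\<close> reads
    \<open>A 0 k j = A 0 i j * A i k j\<close>; positivity allows taking logarithms.\<close>
  have ln_A: "ln (A i k j) = ln (A 0 k j) - ln (A 0 i j)" if "i \<le> n" "k \<le> n" "j \<in> J" for i k j
    using mult[of 0 i k j] pos[of 0 i j] pos[of i k j] that by (simp add: ln_mult)
  \<comment> \<open>The vertex values forced by the conditions on \<open>f\<close>;
    \<open>inv_into\<close> recovers the number of the vertex from its coordinate.\<close>
  define c where "c k = (\<lambda>j. ln (A 0 (inv_into {0..n} e k) j))" for k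
  have c: "c (e i) j = ln (A 0 i j)" if "i \<le> n" for i j
    using bij that by (simp add: c_def bij_betw_inv_into_left)
  have primitive: "is_log_primitive J n e A (bary_fun J c)"
    unfolding is_log_primitive_def
  proof (intro conjI ballI)
    fix i j assume "i \<in> {1..n}" "j \<in> J"
    moreover from this have "i - 1 \<le> n"
      by auto
    ultimately show "bary_fun J c (vertex e (i - 1)) j - bary_fun J c (vertex e i) j = - ln (A (i - 1) i j)"
      using ln_A[of "i - 1" i j] by (simp add: vertex_def bary_fun_axis c)
  qed (simp_all add: affine_fun_bary_fun vertex_def bary_fun_axis c one)
  have unique: "f = bary_fun J c" if f: "is_log_primitive J n e A f" for f
  proof (rule affine_fun_eq_bary_fun)
    show "affine_fun J f"
      using f by (simp add: is_log_primitive_def)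
    \<comment> \<open>Induction telescopes the conditions on consecutive vertices, starting from
      \<open>ln (A 0 0 j) = ln 1 = 0\<close>.\<close>
    have vertex: "f (vertex e i) j = ln (A 0 i j)" if "i \<le> n" "j \<in> J" for i j
      using that(1)
    proof (induction i)
      case 0
      then show ?case
        using f that(2) by (simp add: is_log_primitive_def one)
    next
      case (Suc i)
      then have "Suc i \<in> {1..n}"
        by simp
      then have "f (vertex e (Suc i - 1)) j - f (vertex e (Suc i)) j = - ln (A (Suc i - 1) (Suc i) j)"
        using f that(2) unfolding is_log_primitive_def by blast
      then show ?case
        using Suc that(2) ln_A[of i "Suc i" j] by simp
    qed
    show "f (axis k 1) j = c k j" if j: "j \<in> J" for k j
    proof -
      obtain i where "i \<le> n" "k = e i"
        using bij by (metis UNIV_I atLeastAtMost_iff bij_betw_iff_bijections)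
      then show ?thesis
        using vertex[of i j] j by (simp add: vertex_def c)
    qed
  qed
  have holonomy: "is_holonomy_matrix J n e (const_form J c) A"
    unfolding is_holonomy_matrix_def
  proof (intro allI impI ext)
    fix i k j assume ik: "i \<le> n" "k \<le> n"
    show "A i k j = holonomy J e (const_form J c) i k j"
    proof (cases "j \<in> J")
      case True
      then show ?thesis
        using ik by (simp add: holonomy_const_form c pos flip: ln_A)
    \<comment> \<open>Outside \<open>J\<close> both sides are \<open>undefined\<close>: the left by
      extensionality of the carrier, the right by the restriction in
      \<open>exp_power\<close>.\<close>
    next
      case False
      then show ?thesis
        using PiE_arb[OF carrier[OF ik]] by (simp add: holonomy_def exp_power_def)
    qed
  qed
  have "connection J (const_form J c) \<and> flat J (const_form J c) \<and>
      is_holonomy_matrix J n e (const_form J c) A"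
    using holonomy connection_const_form flat_const_form by blast
  \<comment> \<open>By \<open>unique\<close>, every log primitive is \<open>bary_fun J c\<close>,
    whose differential is \<open>const_form J c\<close>; this one form serves both claims on
    connections.\<close>
  with primitive show ?thesis
    by (auto simp: differential_bary_fun dest: unique)
qed

end
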